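(* Let $(L_n)_{n\ge1}$ and $(\gamma_n)_{n\ge1}$ be integers with $L_n>1$ and $\gamma_n>1$, and let $X$ be the rank-one subshift defined by $B_1=0$ and $B_{n+1}=\big((B_n1)^{\gamma_n}B_n\big)^{L_n}$, with $h_n$ the length of $B_n$ and $p$ its complexity. Then $p(h_{n+1})=\big(1+\frac{1}{L_n}\big)h_{n+1}$ for all $n\ge1$. If moreover $\gamma_n/h_n\to0$, then $$\liminf_{q\to\infty}\frac{p(q)}{q}=1+\liminf_{n\to\infty}\frac{1}{\max(L_{n-1},\gamma_n+1)},\qquad \limsup_{q\to\infty}\frac{p(q)}{q}=\frac32+\limsup_{n\to\infty}\frac{1}{4\min(L_{n-1},\gamma_n+1)-2}.$$
   Context: For a sequence of finite words $B_n$ over $\{0,1\}$ in which each $B_n$ is a prefix and a subword of $B_{n+1}$, the associated subshift is the set of $x\in\{0,1\}^{\mathbb Z}$ all of whose finite subwords are subwords of some $B_n$; $p(q)$ is the number of distinct words of length $q$ occurring in elements of it. Note $h_{n+1}=L_n((\gamma_n+1)h_n+\gamma_n)$. *)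

theory Defs
  imports Complex_Main "HOL-Library.Sublist" "HOL-Library.Extended_Real"
begin

text \<open>The blocks B_n, indexed from 1: B 1 = [0] and
  B (n+1) = ((B n @ [1])^(gamma n) @ B n)^(L n).  B 0 is set to [0] (unused).\<close>
fun rank_block :: "(nat \<Rightarrow> nat) \<Rightarrow> (nat \<Rightarrow> nat) \<Rightarrow> nat \<Rightarrow> nat list" where
  "rank_block L g 0 = [0]"
| "rank_block L g (Suc 0) = [0]"
| "rank_block L g (Suc (Suc n)) =
     concat (replicate (L (Suc n))
       (concat (replicate (g (Suc n)) (rank_block L g (Suc n) @ [1])) @ rank_block L g (Suc n)))"

definition block_len :: "(nat \<Rightarrow> nat) \<Rightarrow> (nat \<Rightarrow> nat) \<Rightarrow> nat \<Rightarrow> nat" where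
  "block_len L g n = length (rank_block L g n)"

definition window :: "(int \<Rightarrow> nat) \<Rightarrow> int \<Rightarrow> nat \<Rightarrow> nat list" where
  "window x i q = map (\<lambda>j. x (i + int j)) [0..<q]"

definition rank_subshift :: "(nat \<Rightarrow> nat) \<Rightarrow> (nat \<Rightarrow> nat) \<Rightarrow> (int \<Rightarrow> nat) set" where
  "rank_subshift L g = {x. (\<forall>i. x i \<in> {0,1}) \<and>
      (\<forall>i q. \<exists>n\<ge>1. sublist (window x i q) (rank_block L g n))}"

definition complexity :: "(nat \<Rightarrow> nat) \<Rightarrow> (nat \<Rightarrow> nat) \<Rightarrow> nat \<Rightarrow> nat" where
  "complexity L g q = card {w. \<exists>x\<in>rank_subshift L g. \<exists>i. w = window x i q}"

end

theory Submission
  imports Defs "HOL-Analysis.Extended_Real_Limits"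
begin

text \<open>Write \<open>B\<close> for a block, \<open>U = (B1)\<^sup>\<gamma>B\<close> for the word whose \<open>L\<close>-th power is the next
  block, and \<open>h\<close>, \<open>u\<close> for the successive lengths of the blocks and of the words \<open>U\<close>. Every prefix of a
  block is left special, and so are the prefixes of \<open>(B1)\<^bsup>2\<gamma>\<^esup>B\<close> and of \<open>U\<^bsup>2L-1\<^esup>\<close>; these leave the
  common path at lengths \<open>u\<close> and \<open>h\<close> (of the next block) respectively, which bounds the increments of \<open>p\<close> from
  below. On the other hand a word of the length of the next block \<open>B'\<close> occurs in \<open>B'1B'\<close> or in \<open>B'B'\<close>, and the
  latter has period \<open>u\<close>, so \<open>p(h) \<le> h + u\<close> there. The lower bounds on the increments add up to exactly
  this value, so all of them are equalities and \<open>p\<close> is piecewise linear with slopes 1 and 2. Its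
  ratio \<open>p(q)/q\<close> has its local minima and maxima at the breakpoints, where the limits are read off.\<close>

section \<open>Powers of words\<close>

abbreviation word_pow :: "'a list \<Rightarrow> nat \<Rightarrow> 'a list" where
  "word_pow w k \<equiv> concat (replicate k w)"

lemma word_pow_add: "word_pow w (j + k) = word_pow w j @ word_pow w k"
  by (simp add: replicate_add)

lemma word_pow_Suc_right: "word_pow w (Suc k) = word_pow w k @ w"
  using word_pow_add[of k 1 w] by simp

lemma length_word_pow: "length (word_pow w k) = k * length w"
  by (induction k) auto

lemma rev_word_pow: "rev (word_pow w k) = word_pow (rev w) k"
  by (simp add: rev_concat)

lemma word_pow_shift: "b @ word_pow (c @ b) k = word_pow (b @ c) k @ b"
  by (induction k) auto

lemma set_word_pow_subset: "set (word_pow w k) \<subseteq> set w"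
  by (induction k) auto

lemma sublist_iff_take_drop:
  "sublist w xs \<longleftrightarrow> (\<exists>i. i + length w \<le> length xs \<and> w = take (length w) (drop i xs))"
proof
  assume "sublist w xs"
  then obtain ps ss where xs: "xs = ps @ w @ ss" by (auto simp: sublist_def)
  then have "length ps + length w \<le> length xs \<and> w = take (length w) (drop (length ps) xs)" by simp
  then show "\<exists>i. i + length w \<le> length xs \<and> w = take (length w) (drop i xs)" by blast
next
  assume "\<exists>i. i + length w \<le> length xs \<and> w = take (length w) (drop i xs)"
  then obtain i where i: "w = take (length w) (drop i xs)" by blast
  have "xs = take i xs @ take (length w) (drop i xs) @ drop (length w) (drop i xs)"
    by (metis append_take_drop_id)
  then show "sublist w xs" using i by (metis sublist_def)
qed

lemma word_pow_periodic:
  assumes "i + length w + N \<le> k * length w"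
  shows "take N (drop (i + length w) (word_pow w k)) = take N (drop i (word_pow w k))"
proof (cases k)
  case 0
  then show ?thesis by simp
next
  case (Suc m)
  have "drop (i + length w) (word_pow w k) = drop i (word_pow w m)"
    by (simp add: Suc)
  moreover have "take N (drop i (word_pow w k)) = take N (drop i (word_pow w m))"
    unfolding Suc word_pow_Suc_right using assms Suc by (simp add: length_word_pow)
  ultimately show ?thesis by simp
qed

text \<open>Whole periods can be subtracted from the start \<open>i\<close> until it falls into the
  first copy of \<open>w\<close>. Hence a power has at most \<open>length w\<close> factors of any
  one length.\<close>

lemma word_pow_factor_reduce:
  assumes "w \<noteq> []" "i + N \<le> k * length w"
  shows "\<exists>j<length w. j + N \<le> k * length w \<and>
           take N (drop i (word_pow w k)) = take N (drop j (word_pow w k))"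
  using assms(2)
proof (induction i rule: less_induct)
  case (less i)
  show ?case
  proof (cases "i < length w")
    case True
    then show ?thesis using less.prems by blast
  next
    case False
    then have i: "i = (i - length w) + length w" by simp
    have "take N (drop i (word_pow w k)) = take N (drop (i - length w) (word_pow w k))"
      using word_pow_periodic[of "i - length w" w N k] less.prems i by simp
    moreover have "i - length w < i" using False assms(1) by (cases w) auto
    ultimately show ?thesis using less.IH[of "i - length w"] less.prems by simp
  qed
qed

section \<open>Concatenations of a block with spacers\<close>

text \<open>All these words begin and end with \<open>b\<close>, so joining two of them, directly or
  across one spacer, stays in the set. This is how a late block looks at the level of an early
  one.\<close>

inductive_set spaced :: "nat list \<Rightarrow> nat list set" for b where
  base: "b \<in> spaced b"
| cat: "y \<in> spaced b \<Longrightarrow> b @ y \<in> spaced b"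
| spacer: "y \<in> spaced b \<Longrightarrow> b @ [1] @ y \<in> spaced b"

lemma spaced_append: "x \<in> spaced b \<Longrightarrow> y \<in> spaced b \<Longrightarrow> x @ y \<in> spaced b"
  by (induction rule: spaced.induct) (use spaced.intros in auto)

lemma spaced_append_spacer: "x \<in> spaced b \<Longrightarrow> y \<in> spaced b \<Longrightarrow> x @ [1] @ y \<in> spaced b"
  by (induction rule: spaced.induct) (use spaced.intros in auto)

lemma spaced_prefix: "y \<in> spaced b \<Longrightarrow> prefix b y"
  by (induction rule: spaced.induct) auto

lemma spaced_word_pow: "x \<in> spaced b \<Longrightarrow> word_pow x (Suc k) \<in> spaced b"
  by (induction k) (auto intro: spaced_append)

lemma spaced_word_pow_spacer: "x \<in> spaced b \<Longrightarrow> word_pow (x @ [1]) k @ x \<in> spaced b"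
  using spaced_append_spacer by (induction k) auto

text \<open>A window as long as \<open>b\<close> that starts in a copy of \<open>b\<close> or on the
  spacer after it ends no later than the next copy, so it sees only one junction. If it starts
  further right, the first copy can be cut off.\<close>

lemma sublist_spaced:
  assumes "y \<in> spaced b" "sublist w y" "length w = length b"
  shows "sublist w (b @ b) \<or> sublist w (b @ [1] @ b)"
  using assms(1,2)
proof (induction rule: spaced.induct)
  case base
  then show ?case by (meson sublist_appendI sublist_order.order_trans sublist_append_leftI sublist_append_rightI)
next
  case (cat y)
  then obtain t where y: "y = b @ t" using spaced_prefix[of y b] by (auto simp: prefix_def)
  obtain i where i: "i + length w \<le> length (b @ y)" "w = take (length w) (drop i (b @ y))"
    using cat.prems by (auto simp: sublist_iff_take_drop)
  show ?case
  proof (cases "i < length b")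
    case True
    then have "w = take (length w) (drop i (b @ b))" using i(2) assms(3) by (simp add: y)
    then show ?thesis using True assms(3) unfolding sublist_iff_take_drop
      by (metis add_le_mono1 length_append less_imp_le_nat)
  next
    case False
    then have "sublist w y" using i unfolding sublist_iff_take_drop
      by (intro exI[of _ "i - length b"]) auto
    then show ?thesis by (rule cat.IH)
  qed
next
  case (spacer y)
  then obtain t where y: "y = b @ t" using spaced_prefix[of y b] by (auto simp: prefix_def)
  obtain i where i: "i + length w \<le> length (b @ [1] @ y)" "w = take (length w) (drop i (b @ [1] @ y))"
    using spacer.prems by (auto simp: sublist_iff_take_drop)
  show ?case
  \<comment> \<open>Equality is included: the window then starts on the spacer and still ends inside
    the following copy.\<close>
  proof (cases "i \<le> length b")
    case True
    then have "w = take (length w) (drop i ((b @ [1]) @ b))"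
      using i(2) assms(3) unfolding y append_assoc[symmetric] drop_append[of _ "(b @ [1]) @ b" t]
      by (simp del: drop_append append_assoc)
    then show ?thesis using True assms(3) unfolding sublist_iff_take_drop
      by (intro disjI2 exI[of _ i]) auto
  next
    case False
    then have "sublist w y" using i unfolding sublist_iff_take_drop
      by (intro exI[of _ "i - length b - 1"]) (auto simp: drop_Cons' simp flip: drop_drop)
    then show ?thesis by (rule spacer.IH)
  qed
qed

section \<open>Blocks and their language\<close>

locale rank_one =
  fixes L g :: "nat \<Rightarrow> nat"
  assumes L_gt_1: "n \<ge> 1 \<Longrightarrow> L n > 1" and g_gt_1: "n \<ge> 1 \<Longrightarrow> g n > 1"
begin

text \<open>Indices are shifted by one so that recursion and induction start at 0:
  \<open>blk n\<close> is the block B_(n+1), and the parameters that lead to the next block are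
  \<open>g (Suc n)\<close> and \<open>L (Suc n)\<close>.\<close>

definition blk :: "nat \<Rightarrow> nat list" where
  "blk n = rank_block L g (Suc n)"

definition ublk :: "nat \<Rightarrow> nat list" where
  "ublk n = word_pow (blk n @ [1]) (g (Suc n)) @ blk n"

definition lang :: "nat list set" where
  "lang = {w. \<exists>n. sublist w (blk n)}"

definition lang_len :: "nat \<Rightarrow> nat list set" where
  "lang_len q = {w \<in> lang. length w = q}"

definition left_special :: "nat list \<Rightarrow> bool" where
  "left_special w \<longleftrightarrow> 0 # w \<in> lang \<and> 1 # w \<in> lang"

lemma blk_0: "blk 0 = [0]"
  by (simp add: blk_def)

lemma blk_Suc: "blk (Suc n) = word_pow (ublk n) (L (Suc n))"
  by (simp add: blk_def ublk_def)

lemma obtain_g: obtains k where "g (Suc n) = Suc (Suc k)"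
  using g_gt_1[of "Suc n"] that[of "g (Suc n) - 2"] by simp

lemma obtain_L: obtains k where "L (Suc n) = Suc (Suc k)"
  using L_gt_1[of "Suc n"] that[of "L (Suc n) - 2"] by simp

lemma ublk_left: "\<exists>s. ublk n = blk n @ [1] @ blk n @ s"
  by (rule obtain_g[of n]) (simp add: ublk_def)

lemma ublk_right: "\<exists>p. ublk n = p @ blk n @ [1] @ blk n"
proof -
  obtain k where "g (Suc n) = Suc (Suc k)" by (rule obtain_g)
  then have "ublk n = word_pow (blk n @ [1]) (Suc k) @ blk n @ [1] @ blk n"
    unfolding ublk_def by (simp only: word_pow_Suc_right append_assoc)
  then show ?thesis by blast
qed

lemma blk_Suc_left: "\<exists>s. blk (Suc n) = ublk n @ ublk n @ s"
  by (rule obtain_L[of n]) (simp add: blk_Suc)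

lemma blk_Suc_right: "\<exists>p. blk (Suc n) = p @ ublk n @ ublk n"
proof -
  obtain k where "L (Suc n) = Suc (Suc k)" by (rule obtain_L)
  then have "blk (Suc n) = word_pow (ublk n) k @ ublk n @ ublk n"
    unfolding blk_Suc by (simp only: word_pow_Suc_right append_assoc)
  then show ?thesis by blast
qed

lemma prefix_blk_ublk: "prefix (blk n) (ublk n)"
  using ublk_left[of n] by (auto simp: prefix_def)

lemma prefix_ublk_blk: "prefix (ublk n) (blk (Suc n))"
  using blk_Suc_left[of n] by (auto simp: prefix_def)

lemma prefix_blk_mono: "m \<le> n \<Longrightarrow> prefix (blk m) (blk n)"
proof (induction n rule: dec_induct)
  case (step n)
  then show ?case
    using prefix_blk_ublk[of n] prefix_ublk_blk[of n] prefix_order.order_trans by blast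
qed simp

text \<open>Reversal turns (B1)^g B into B(1B)^g for a palindrome B, and moving the brackets gives
  back (B1)^g B; powers of a palindrome are palindromes.\<close>

lemma rev_blk: "rev (blk n) = blk n"
proof (induction n)
  case 0
  then show ?case by (simp add: blk_0)
next
  case (Suc n)
  have "rev (ublk n) = ublk n"
    using word_pow_shift[where b = "blk n" and c = "[1]" and k = "g (Suc n)"] by (simp add: ublk_def rev_word_pow Suc)
  then show ?case by (simp add: blk_Suc rev_word_pow)
qed

lemma blk_begins_0: "\<exists>t. blk n = 0 # t"
  using prefix_blk_mono[of 0 n] by (auto simp: blk_0 prefix_def)

lemma blk_ends_0: "\<exists>t. blk n = t @ [0]"
  using blk_begins_0[of n] rev_blk[of n] by (metis rev.simps(2))

lemma ublk_begins_0: "\<exists>t. ublk n = 0 # t"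
  using blk_begins_0[of n] ublk_left[of n] by (metis append_Cons)

lemma ublk_ends_0: "\<exists>t. ublk n = t @ [0]"
  using blk_ends_0[of n] unfolding ublk_def by (metis append_assoc)

lemma set_blk: "set (blk n) \<subseteq> {0, 1}"
proof (induction n)
  case (Suc n)
  have "set (ublk n) \<subseteq> {0, 1}"
    using Suc set_word_pow_subset[where w = "blk n @ [1]" and k = "g (Suc n)"] unfolding ublk_def by auto
  then show ?case using set_word_pow_subset[where w = "ublk n" and k = "L (Suc n)"] by (simp add: blk_Suc)
qed (simp add: blk_0)

lemma length_ublk: "length (ublk n) = (g (Suc n) + 1) * length (blk n) + g (Suc n)"
  by (simp add: ublk_def length_word_pow algebra_simps)

lemma length_blk_Suc: "length (blk (Suc n)) = L (Suc n) * length (ublk n)"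
  by (simp add: blk_Suc length_word_pow)

lemma length_blk_pos: "length (blk n) > 0"
  using blk_begins_0[of n] by auto

lemma length_ublk_ge: "2 * length (blk n) < length (ublk n)"
  using ublk_left[of n] by auto

lemma length_blk_Suc_ge: "2 * length (ublk n) \<le> length (blk (Suc n))"
  using blk_Suc_left[of n] by auto

lemma length_blk_gt: "length (blk n) > n"
proof (induction n)
  case (Suc n)
  then show ?case using length_ublk_ge[of n] length_blk_Suc_ge[of n] by linarith
qed (simp add: blk_0)

section \<open>Words of the language found at the junctions of blocks\<close>

lemma lang_sublist: "w \<in> lang \<Longrightarrow> sublist v w \<Longrightarrow> v \<in> lang"
  unfolding lang_def using sublist_order.order_trans by blast

lemma blk_in_lang: "blk n \<in> lang"
  by (auto simp: lang_def)

lemma ublk_ublk_in_lang: "ublk n @ ublk n \<in> lang"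
proof -
  obtain s where "blk (Suc n) = (ublk n @ ublk n) @ s" using blk_Suc_left[of n] by auto
  then show ?thesis using lang_sublist[OF blk_in_lang] sublist_append_rightI by metis
qed

lemma blk_spacer_blk_in_lang: "blk n @ [1] @ blk n \<in> lang"
proof -
  obtain s where "ublk n = (blk n @ [1] @ blk n) @ s" using ublk_left[of n] by auto
  then have "sublist (blk n @ [1] @ blk n) (ublk n @ ublk n)"
    by (metis append_assoc sublist_append_rightI)
  then show ?thesis using lang_sublist[OF ublk_ublk_in_lang] by blast
qed

lemma blk_blk_in_lang: "blk n @ blk n \<in> lang"
proof -
  obtain p s where "ublk n = p @ blk n" "ublk n = blk n @ s"
    using ublk_left[of n] ublk_right[of n] by (metis append_assoc)
  then have "ublk n @ ublk n = p @ (blk n @ blk n) @ s" by (metis append_assoc)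
  then show ?thesis using lang_sublist[OF ublk_ublk_in_lang[of n]] sublist_appendI by metis
qed

text \<open>Where two copies of \<open>ublk n\<close> meet, the last \<open>blk n\<close> of the
  first copy has a spacer before it and none after it.\<close>

lemma spacer_blk_blk_in_lang: "1 # blk n @ blk n \<in> lang"
proof -
  obtain p s where "ublk n = (p @ blk n) @ [1] @ blk n" "ublk n = blk n @ s"
    using ublk_left[of n] ublk_right[of n] by (metis append_assoc)
  then have "ublk n @ ublk n = (p @ blk n) @ (1 # blk n @ blk n) @ s"
    by (metis append_assoc append_Cons append_Nil)
  then show ?thesis using lang_sublist[OF ublk_ublk_in_lang[of n]] sublist_appendI by metis
qed

section \<open>The language of the subshift\<close>

lemma window_append: "window x i (q + r) = window x i q @ window x (i + int q) r"
proof -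
  have "window x (i + int q) r = map (\<lambda>j. x (i + int j)) [q..<q + r]"
    unfolding window_def by (rule nth_equalityI) (auto simp: add.assoc)
  then show ?thesis
    unfolding window_def by (metis le_add1 map_append upt_add_eq_append zero_le)
qed

lemma sublist_window:
  assumes "a \<le> i" "i + int q \<le> a + int r"
  shows "sublist (window x i q) (window x a r)"
proof -
  define j k where "j = nat (i - a)" and "k = nat (a + int r - i - int q)"
  have "r = j + (q + k)" using assms unfolding j_def k_def by linarith
  then have "window x a r = window x a (j + (q + k))" by simp
  also have "\<dots> = window x a j @ window x i q @ window x (i + int q) k"
    unfolding window_append using assms by (simp add: j_def)
  finally show ?thesis by simp
qed

text \<open>As blocks are palindromes, mirroring their limit at the origin puts a copy of
  \<open>blk n @ blk n\<close> around the origin for every \<open>n\<close> at once.\<close>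

definition two_sided :: "int \<Rightarrow> nat" where
  "two_sided i = (let j = (if i \<ge> 0 then nat i else nat (- i - 1)) in blk j ! j)"

text \<open>Blocks are prefixes of one another, so the diagonal entry \<open>blk j ! j\<close> is
  the letter at position \<open>j\<close> of their common limit; \<open>length_blk_gt\<close> makes
  \<open>j\<close> a valid position.\<close>

lemma blk_nth_diag: "j < length (blk n) \<Longrightarrow> blk j ! j = blk n ! j"
proof -
  assume j: "j < length (blk n)"
  consider "prefix (blk j) (blk n)" | "prefix (blk n) (blk j)"
    using prefix_blk_mono nat_le_linear by blast
  then show ?thesis
    using j length_blk_gt[of j] by cases (auto simp: prefix_def nth_append)
qed

lemma window_two_sided:
  "window two_sided (- int (length (blk n))) (length (blk n) + length (blk n)) = blk n @ blk n"
proof -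
  let ?h = "length (blk n)"
  have "window two_sided 0 ?h = blk n"
    by (rule nth_equalityI) (auto simp: window_def two_sided_def blk_nth_diag)
  moreover have "window two_sided (- int ?h) ?h = rev (blk n)"
  proof (rule nth_equalityI)
    fix i assume "i < length (window two_sided (- int ?h) ?h)"
    then have i: "i < ?h" by (simp add: window_def)
    then have "nat (- (- int ?h + int i) - 1) = ?h - Suc i" "- int ?h + int i < 0" by auto
    then show "window two_sided (- int ?h) ?h ! i = rev (blk n) ! i"
      using i by (simp add: window_def two_sided_def rev_nth blk_nth_diag Let_def)
  qed (simp add: window_def)
  ultimately show ?thesis by (simp add: window_append rev_blk)
qed

lemma two_sided_in_subshift: "two_sided \<in> rank_subshift L g"
proof -
  have "\<exists>n\<ge>1. sublist (window two_sided i q) (rank_block L g n)" for i q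
  proof -
    \<comment> \<open>With this \<open>n\<close> the block is longer than both ends of the window
      are far from the origin, so the window lies in the central copy of
      \<open>blk n @ blk n\<close>.\<close>
    define n where "n = nat \<bar>i\<bar> + q"
    have "int n < int (length (blk n))" using length_blk_gt[of n] by simp
    then have "sublist (window two_sided i q) (blk n @ blk n)"
      unfolding window_two_sided[symmetric] by (intro sublist_window) (auto simp: n_def)
    then obtain m where "sublist (window two_sided i q) (blk m)"
      using lang_sublist[OF blk_blk_in_lang] by (auto simp: lang_def)
    then show ?thesis by (auto simp: blk_def)
  qed
  moreover have "two_sided i \<in> {0, 1}" for i
  proof -
    have "blk j ! j \<in> set (blk j)" for j using length_blk_gt by simp
    then have "blk j ! j \<in> {0, 1}" for j using set_blk by blast
    then show ?thesis unfolding two_sided_def Let_def by blast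
  qed
  ultimately show ?thesis by (simp add: rank_subshift_def)
qed

text \<open>The single point \<open>two_sided\<close> already contains every word of
  \<open>lang\<close>, since it shows each \<open>blk n @ blk n\<close> at the origin. Counting
  words of the subshift thus becomes counting factors of blocks.\<close>

lemma complexity_eq: "complexity L g q = card (lang_len q)"
proof -
  have "w \<in> lang_len q \<longleftrightarrow> (\<exists>x\<in>rank_subshift L g. \<exists>i. w = window x i q)" for w
  proof
    assume "w \<in> lang_len q"
    then obtain n where n: "sublist w (blk n)" "length w = q"
      by (auto simp: lang_len_def lang_def)
    then have "sublist w (blk n @ blk n)"
      by (meson sublist_order.order_trans sublist_append_leftI)
    then obtain a where a: "a + q \<le> length (blk n @ blk n)" "w = take q (drop a (blk n @ blk n))"
      using n(2) by (auto simp: sublist_iff_take_drop)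
    let ?h = "length (blk n)"
    obtain r where r: "?h + ?h = a + (q + r)"
      using a(1) by (metis length_append le_Suc_ex add.assoc)
    have "blk n @ blk n = window two_sided (- int ?h) a @ window two_sided (- int ?h + int a) q
        @ window two_sided (- int ?h + int a + int q) r"
      using window_two_sided[of n] unfolding r window_append by simp
    then have "w = window two_sided (- int ?h + int a) q"
      using a(2) by (simp add: window_def)
    then show "\<exists>x\<in>rank_subshift L g. \<exists>i. w = window x i q"
      using two_sided_in_subshift by blast
  next
    assume "\<exists>x\<in>rank_subshift L g. \<exists>i. w = window x i q"
    then obtain x i where x: "x \<in> rank_subshift L g" "w = window x i q" by blast
    then obtain n where "n \<ge> 1" "sublist w (rank_block L g n)"
      unfolding rank_subshift_def by blast
    moreover obtain m where "n = Suc m" using \<open>n \<ge> 1\<close> by (cases n) auto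
    ultimately have "w \<in> lang" unfolding lang_def blk_def by blast
    then show "w \<in> lang_len q" using x(2) by (simp add: lang_len_def window_def)
  qed
  then have "{w. \<exists>x\<in>rank_subshift L g. \<exists>i. w = window x i q} = lang_len q" by blast
  then show ?thesis by (simp add: complexity_def)
qed

section \<open>Left special words\<close>

lemma set_lang: "w \<in> lang \<Longrightarrow> set w \<subseteq> {0, 1}"
  using set_blk set_mono_sublist by (fastforce simp: lang_def)

lemma finite_lang_len: "finite (lang_len q)"
proof (rule finite_subset)
  show "lang_len q \<subseteq> {w. set w \<subseteq> {0, 1} \<and> length w = q}"
    using set_lang by (auto simp: lang_len_def)
qed (simp add: finite_lists_length_eq)

lemma lang_extend_left: "w \<in> lang \<Longrightarrow> \<exists>c \<in> {0, 1}. c # w \<in> lang"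
proof -
  assume "w \<in> lang"
  then obtain n ps ss where n: "blk n = ps @ w @ ss" by (auto simp: lang_def sublist_def)
  \<comment> \<open>The letter \<open>last (1 # ps)\<close> is the left neighbour of
    \<open>w\<close>: the last letter of \<open>ps\<close>, or the spacer in front of the block if
    \<open>ps\<close> is empty.\<close>
  have "sublist (last (1 # ps) # w) (blk n @ [1] @ blk n)"
  proof -
    have "blk n @ [1] @ blk n = (blk n @ butlast (1 # ps)) @ (last (1 # ps) # w) @ ss"
      using append_butlast_last_id[of "1 # ps"] unfolding n
      by (metis append.assoc append_Cons append_Nil list.distinct(1))
    then show ?thesis by (metis sublist_appendI)
  qed
  then have "last (1 # ps) # w \<in> lang" using lang_sublist[OF blk_spacer_blk_in_lang] by blast
  moreover from this have "last (1 # ps) \<in> {0, 1}" using set_lang by fastforce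
  ultimately show ?thesis by blast
qed

text \<open>Split the words of length \<open>Suc q\<close> by first letter and delete it. The two
  resulting sets cover \<open>lang_len q\<close>, and both contain the left special words;
  inclusion-exclusion gives the bound.\<close>

lemma card_lang_len_step:
  assumes "\<And>w. w \<in> S \<Longrightarrow> left_special w \<and> length w = q"
  shows "card (lang_len q) + card S \<le> card (lang_len (Suc q))"
proof -
  define E where "E c = {w. c # w \<in> lang_len (Suc q)}" for c
  have E: "Cons c ` E c \<subseteq> lang_len (Suc q)" for c by (auto simp: E_def)
  then have fin: "finite (E c)" for c
    by (metis finite_imageD finite_lang_len finite_subset inj_on_Cons1)
  have "lang_len q \<subseteq> E 0 \<union> E 1"
    using lang_extend_left by (auto simp: E_def lang_len_def)
  moreover have "S \<subseteq> E 0 \<inter> E 1"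
    using assms by (auto simp: E_def lang_len_def left_special_def)
  ultimately have "card (lang_len q) + card S \<le> card (E 0 \<union> E 1) + card (E 0 \<inter> E 1)"
    by (intro add_mono card_mono) (auto simp: fin)
  also have "\<dots> = card (E 0) + card (E 1)"
    using card_Un_Int[OF fin fin] by simp
  also have "\<dots> = card (Cons 0 ` E 0) + card (Cons 1 ` E 1)"
    by (simp add: card_image)
  also have "\<dots> = card (Cons 0 ` E 0 \<union> Cons 1 ` E 1)"
    by (rule card_Un_disjoint[symmetric]) (auto simp: fin)
  also have "\<dots> \<le> card (lang_len (Suc q))"
    using E by (intro card_mono finite_lang_len) auto
  finally show ?thesis .
qed

lemma left_special_prefix: "left_special w \<Longrightarrow> prefix v w \<Longrightarrow> left_special v"
  unfolding left_special_def
  by (meson Cons_prefix_Cons lang_sublist prefix_imp_sublist)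

lemma left_special_blk: "left_special (blk n)"
proof -
  obtain t where t: "blk n = t @ [0]" using blk_ends_0 by blast
  have "sublist (0 # blk n) (blk n @ blk n)"
    by (subst (2) t) simp
  moreover have "sublist (1 # blk n) (blk n @ [1] @ blk n)" by simp
  ultimately show ?thesis
    unfolding left_special_def using lang_sublist blk_blk_in_lang blk_spacer_blk_in_lang by meson
qed

text \<open>One period \<open>blk n @ [1]\<close> less than U1U = (B1)^(2g+1) B, so it is both a
  prefix and a suffix of U1U.\<close>

definition spaced_special :: "nat \<Rightarrow> nat list" where
  "spaced_special n = word_pow (blk n @ [1]) (2 * g (Suc n)) @ blk n"

text \<open>One period less than the square of the next block, which is the power of
  \<open>ublk n\<close> with exponent 2L.\<close>

definition unspaced_special :: "nat \<Rightarrow> nat list" where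
  "unspaced_special n = word_pow (ublk n) (2 * L (Suc n) - 1)"

lemma ublk_spacer_ublk:
  "ublk n @ [1] @ ublk n = blk n @ [1] @ spaced_special n"
  "ublk n @ [1] @ ublk n = spaced_special n @ [1] @ blk n"
proof -
  let ?p = "word_pow (blk n @ [1])" and ?g = "g (Suc n)"
  have "ublk n @ [1] @ ublk n = ?p ?g @ (blk n @ [1]) @ ?p ?g @ blk n"
    by (simp add: ublk_def)
  also have "\<dots> = ?p (?g + Suc ?g) @ blk n"
    unfolding word_pow_add by simp
  finally have *: "ublk n @ [1] @ ublk n = ?p (Suc (2 * ?g)) @ blk n"
    by (simp add: mult_2)
  then show "ublk n @ [1] @ ublk n = blk n @ [1] @ spaced_special n"
    by (simp add: spaced_special_def)
  from * show "ublk n @ [1] @ ublk n = spaced_special n @ [1] @ blk n"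
    unfolding word_pow_Suc_right spaced_special_def by simp
qed

text \<open>The word UU1U occurs across the spacer between two next blocks. As a prefix of its
  factor U1U, the special word follows the final 0 of the first U; as a suffix, it follows a
  spacer.\<close>

lemma left_special_spaced: "left_special (spaced_special n)"
proof -
  let ?U = "ublk n"
  obtain p s where p: "blk (Suc n) = p @ ?U @ ?U" and s: "blk (Suc n) = ?U @ s"
    using blk_Suc_left[of n] blk_Suc_right[of n] by metis
  have "blk (Suc n) @ [1] @ blk (Suc n) = p @ (?U @ ?U @ [1] @ ?U) @ s"
    by (subst (2) s, subst p) simp
  then have lang: "?U @ ?U @ [1] @ ?U \<in> lang"
    using lang_sublist[OF blk_spacer_blk_in_lang[of "Suc n"]] sublist_appendI by metis
  obtain t where t: "?U = t @ [0]" using ublk_ends_0 by blast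
  have "?U @ ?U @ [1] @ ?U = t @ (0 # spaced_special n) @ [1] @ blk n"
    unfolding ublk_spacer_ublk(2) by (subst t) simp
  then have "0 # spaced_special n \<in> lang"
    using lang_sublist[OF lang] sublist_appendI by metis
  moreover have "?U @ ?U @ [1] @ ?U = (?U @ blk n) @ (1 # spaced_special n) @ []"
    unfolding ublk_spacer_ublk(1) by simp
  then have "1 # spaced_special n \<in> lang"
    using lang_sublist[OF lang] sublist_appendI by metis
  ultimately show ?thesis by (simp add: left_special_def)
qed

lemma blk_Suc_blk_Suc:
  "blk (Suc n) @ blk (Suc n) = ublk n @ unspaced_special n"
  "blk (Suc n) @ blk (Suc n) = unspaced_special n @ ublk n"
proof -
  obtain k where k: "2 * L (Suc n) = Suc k" "2 * L (Suc n) - 1 = k"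
    by (rule obtain_L[of n]) simp
  have "blk (Suc n) @ blk (Suc n) = word_pow (ublk n) (2 * L (Suc n))"
    by (simp only: blk_Suc mult_2 word_pow_add)
  then have *: "blk (Suc n) @ blk (Suc n) = word_pow (ublk n) (Suc k)" by (simp only: k)
  then show "blk (Suc n) @ blk (Suc n) = ublk n @ unspaced_special n"
    by (simp add: unspaced_special_def k)
  from * show "blk (Suc n) @ blk (Suc n) = unspaced_special n @ ublk n"
    unfolding unspaced_special_def k(2) word_pow_Suc_right .
qed

text \<open>As a suffix of the square of the next block, the word follows the final 0 of a U; as a
  prefix, it follows the spacer that may precede that square.\<close>

lemma left_special_unspaced: "left_special (unspaced_special n)"
proof -
  obtain t where t: "ublk n = t @ [0]" using ublk_ends_0 by blast
  have "blk (Suc n) @ blk (Suc n) = t @ (0 # unspaced_special n) @ []"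
    unfolding blk_Suc_blk_Suc(1) by (subst t) simp
  then have "0 # unspaced_special n \<in> lang"
    using lang_sublist[OF blk_blk_in_lang] sublist_appendI by metis
  moreover have "1 # unspaced_special n \<in> lang"
    using spacer_blk_blk_in_lang[of "Suc n"] unfolding blk_Suc_blk_Suc(2)
    by (rule lang_sublist) (metis append_Cons sublist_append_rightI)
  ultimately show ?thesis by (simp add: left_special_def)
qed

lemma length_spaced_special: "length (spaced_special n) = 2 * length (ublk n) - length (blk n)"
  by (simp add: spaced_special_def length_ublk length_word_pow algebra_simps)

lemma length_unspaced_special:
  "length (unspaced_special n) = 2 * length (blk (Suc n)) - length (ublk n)"
  by (simp add: unspaced_special_def length_blk_Suc length_word_pow algebra_simps)

section \<open>Lower bounds for the increments of the complexity\<close>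

lemma card_lang_len_step_1: "card (lang_len q) + 1 \<le> card (lang_len (Suc q))"
proof -
  have "left_special (take q (blk q))"
    by (rule left_special_prefix[OF left_special_blk take_is_prefix])
  moreover have "length (take q (blk q)) = q" using length_blk_gt[of q] by simp
  ultimately show ?thesis using card_lang_len_step[of "{take q (blk q)}" q] by simp
qed

text \<open>Beyond the branching point at the end of \<open>v\<close>, the prefixes of length
  \<open>q\<close> of \<open>w\<close> and of the block are two different left special
  words.\<close>

lemma card_lang_len_step_2:
  assumes w: "left_special w" "prefix (v @ [1 - c]) w" "prefix (v @ [c]) (blk m)" "c \<in> {0, 1}"
    and q: "length v < q" "q \<le> length w" "q \<le> length (blk m)"
  shows "card (lang_len q) + 2 \<le> card (lang_len (Suc q))"
proof -
  have nth: "take q x ! length v = d" if "prefix (v @ [d]) x" for x d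
  proof -
    from that obtain s where "x = v @ [d] @ s" by (auto simp: prefix_def)
    then show ?thesis using q(1) by (simp add: nth_append)
  qed
  have "take q w \<noteq> take q (blk m)"
  proof
    assume "take q w = take q (blk m)"
    then have "1 - c = c" using nth[OF w(2)] nth[OF w(3)] by simp
    then show False using w(4) by auto
  qed
  then have card: "card {take q w, take q (blk m)} = 2" by simp
  have "left_special (take q w)" "left_special (take q (blk m))"
    by (rule left_special_prefix[OF w(1) take_is_prefix] left_special_prefix[OF left_special_blk take_is_prefix])+
  then have "card (lang_len q) + card {take q w, take q (blk m)} \<le> card (lang_len (Suc q))"
    using q(2,3) by (intro card_lang_len_step) auto
  then show ?thesis by (simp only: card)
qed

text \<open>The branching point is the end of \<open>ublk n\<close>: the special word goes on with a
  spacer, the block with the first letter 0 of another \<open>ublk n\<close>.\<close>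

lemma card_lang_len_step_spaced:
  assumes "length (ublk n) < q" "q \<le> 2 * length (ublk n) - length (blk n)"
  shows "card (lang_len q) + 2 \<le> card (lang_len (Suc q))"
proof (rule card_lang_len_step_2[where v = "ublk n" and c = 0 and m = "Suc n"])
  obtain k where k: "g (Suc n) = Suc (Suc k)" by (rule obtain_g)
  have "spaced_special n = word_pow (blk n @ [1]) (g (Suc n)) @ word_pow (blk n @ [1]) (Suc (Suc k)) @ blk n"
    unfolding spaced_special_def mult_2 word_pow_add k by simp
  then show "prefix (ublk n @ [1 - 0]) (spaced_special n)"
    by (simp add: ublk_def)
  obtain s t where "blk (Suc n) = ublk n @ ublk n @ s" "ublk n = 0 # t"
    using blk_Suc_left ublk_begins_0 by blast
  then have "blk (Suc n) = ublk n @ [0] @ t @ s" by simp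
  then show "prefix (ublk n @ [0]) (blk (Suc n))" by simp
  show "q \<le> length (blk (Suc n))" using assms length_blk_Suc_ge[of n] by linarith
qed (use assms in \<open>auto simp: left_special_spaced length_spaced_special\<close>)

text \<open>The branching point is the end of \<open>blk (Suc n)\<close>: the special word, whose
  exponent 2L-1 exceeds L, goes on with the 0 of another \<open>ublk n\<close>, while the longer
  block goes on with a spacer.\<close>

lemma card_lang_len_step_unspaced:
  assumes "length (blk (Suc n)) < q" "q \<le> 2 * length (blk (Suc n)) - length (ublk n)"
  shows "card (lang_len q) + 2 \<le> card (lang_len (Suc q))"
proof (rule card_lang_len_step_2[where v = "blk (Suc n)" and c = 1 and m = "Suc (Suc n)"])
  obtain k where k: "L (Suc n) = Suc (Suc k)" by (rule obtain_L)
  obtain t where t: "ublk n = 0 # t" using ublk_begins_0 by blast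
  have "2 * L (Suc n) - 1 = L (Suc n) + Suc k" using k by simp
  then have "unspaced_special n = word_pow (ublk n) (L (Suc n) + Suc k)"
    unfolding unspaced_special_def by (rule arg_cong)
  then have "unspaced_special n = blk (Suc n) @ ublk n @ word_pow (ublk n) k"
    unfolding word_pow_add blk_Suc by simp
  then have "unspaced_special n = blk (Suc n) @ [0] @ t @ word_pow (ublk n) k"
    using t by simp
  then show "prefix (blk (Suc n) @ [1 - 1]) (unspaced_special n)" by simp
  obtain s where "ublk (Suc n) = blk (Suc n) @ [1] @ s"
    using ublk_left by blast
  then have "prefix (blk (Suc n) @ [1]) (ublk (Suc n))" by simp
  then show "prefix (blk (Suc n) @ [1]) (blk (Suc (Suc n)))"
    using prefix_ublk_blk prefix_order.order_trans by blast
  show "q \<le> length (blk (Suc (Suc n)))"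
    using assms length_ublk_ge[of "Suc n"] length_blk_Suc_ge[of "Suc n"] by linarith
qed (use assms in \<open>auto simp: left_special_unspaced length_unspaced_special\<close>)

section \<open>Upper bound for the complexity\<close>

lemma blk_in_spaced: "n \<le> m \<Longrightarrow> blk m \<in> spaced (blk n)"
proof (induction m rule: dec_induct)
  case base
  then show ?case by (rule spaced.base)
next
  case (step m)
  obtain k where k: "L (Suc m) = Suc (Suc k)" by (rule obtain_L)
  have "ublk m \<in> spaced (blk n)"
    unfolding ublk_def using step.IH by (rule spaced_word_pow_spacer)
  then show ?case unfolding blk_Suc k by (rule spaced_word_pow)
qed

text \<open>Let N be the length of the next block B' and u that of U. The starts 0 to N in B'1B'
  give at most N+1 words, and start N+1 gives B' again. As B'B' has period u, only its starts 1 to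
  u-1 can add words, start 0 giving B' again. The sum is N+u.\<close>

lemma card_lang_len_blk:
  "card (lang_len (length (blk (Suc n)))) \<le> length (blk (Suc n)) + length (ublk n)"
proof -
  let ?b = "blk (Suc n)" and ?u = "length (ublk n)"
  let ?N = "length ?b"
  let ?X = "(\<lambda>i. take ?N (drop i (?b @ [1] @ ?b))) ` {..?N}"
  let ?Y = "(\<lambda>i. take ?N (drop i (?b @ ?b))) ` {1..<?u}"
  have b_in: "?b \<in> ?X" by (rule image_eqI[of _ _ 0]) auto
  have "lang_len ?N \<subseteq> ?X \<union> ?Y"
  proof
    fix w assume "w \<in> lang_len ?N"
    then obtain m where w: "length w = ?N" "sublist w (blk m)"
      by (auto simp: lang_len_def lang_def)
    have "blk (max m (Suc n)) \<in> spaced ?b" by (rule blk_in_spaced) simp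
    moreover have "sublist w (blk (max m (Suc n)))"
      using w(2) prefix_blk_mono[of m "max m (Suc n)"] sublist_order.order_trans by fastforce
    ultimately consider "sublist w (?b @ ?b)" | "sublist w (?b @ [1] @ ?b)"
      using sublist_spaced w(1) by blast
    then show "w \<in> ?X \<union> ?Y"
    proof cases
      case 1
      then obtain i where i: "i + ?N \<le> ?N + ?N" "w = take ?N (drop i (?b @ ?b))"
        by (auto simp: sublist_iff_take_drop w(1))
      have bb: "?b @ ?b = word_pow (ublk n) (2 * L (Suc n))"
        by (simp only: blk_Suc mult_2 word_pow_add)
      have "ublk n \<noteq> []" using ublk_begins_0[of n] by auto
      moreover have "?N + ?N = 2 * L (Suc n) * ?u" by (simp add: length_blk_Suc)
      ultimately obtain j where "j < ?u" "w = take ?N (drop j (?b @ ?b))"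
        using word_pow_factor_reduce[where w = "ublk n" and i = i and N = ?N and k = "2 * L (Suc n)"] i unfolding bb by auto
      then show ?thesis using b_in by (cases "j = 0") auto
    next
      case 2
      then obtain i where i: "i + ?N \<le> ?N + ?N + 1" "w = take ?N (drop i (?b @ [1] @ ?b))"
        by (auto simp: sublist_iff_take_drop w(1))
      show ?thesis
      proof (cases "i \<le> ?N")
        case True
        then show ?thesis using i(2) by blast
      next
        case False
        then have "i = ?N + 1" using i(1) by simp
        then have "w = ?b" using i(2) by simp
        then show ?thesis using b_in by simp
      qed
    qed
  qed
  then have "card (lang_len ?N) \<le> card (?X \<union> ?Y)" by (rule card_mono[rotated]) simp
  also have "\<dots> \<le> card ?X + card ?Y" by (rule card_Un_le)
  also have "\<dots> \<le> card {..?N} + card {1..<?u}" by (intro add_mono card_image_le) auto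
  also have "\<dots> = ?N + ?u" using ublk_begins_0[of n] by auto
  finally show ?thesis .
qed

lemma lang_len_0: "lang_len 0 = {[]}"
  by (auto simp: lang_len_def lang_def)

end

section \<open>From growth conditions to an explicit formula\<close>

text \<open>Abstracts the interleaved lengths h, u, h', u', ... of blocks and words U. Both families
  of left special words then yield increments of 2 on intervals of one shape, from
  \<open>a (Suc k)\<close> to \<open>2 * a (Suc k) - a k\<close>.\<close>

locale doubling =
  fixes a :: "nat \<Rightarrow> nat"
  assumes a_0: "a 0 = 1" and a_double: "2 * a k \<le> a (Suc k)"
begin

lemma a_pos: "a k > 0"
proof (induction k)
  case (Suc k)
  then show ?case using a_double[of k] by linarith
qed (simp add: a_0)

lemma a_mono: "j \<le> k \<Longrightarrow> a j \<le> a k"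
proof (induction k rule: dec_induct)
  case (step k)
  then show ?case using a_double[of k] by linarith
qed simp

lemma a_gt: "k < a k"
proof (induction k)
  case (Suc k)
  then show ?case using a_double[of k] by linarith
qed (simp add: a_0)

definition jump :: "nat \<Rightarrow> bool" where
  "jump q \<longleftrightarrow> (\<exists>k. a (Suc k) < q \<and> q \<le> 2 * a (Suc k) - a k)"

definition profile :: "nat \<Rightarrow> nat" where
  "profile q = 1 + (\<Sum>r<q. 1 + of_bool (jump r))"

lemma profile_Suc: "profile (Suc q) = profile q + 1 + of_bool (jump q)"
  by (simp add: profile_def)

text \<open>The doubling condition makes each interval of jumps end before the next one begins, so
  only one of them matters in this range.\<close>

lemma jump_iff:
  assumes "a (Suc k) < q" "q \<le> a (Suc (Suc k))"
  shows "jump q \<longleftrightarrow> q \<le> 2 * a (Suc k) - a k"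
proof
  assume "jump q"
  then obtain j where j: "a (Suc j) < q" "q \<le> 2 * a (Suc j) - a j"
    by (auto simp: jump_def)
  have "j = k"
  proof (rule ccontr)
    assume "j \<noteq> k"
    then consider "Suc (Suc j) \<le> Suc k" | "Suc (Suc k) \<le> Suc j" by linarith
    then show False
    proof cases
      case 1
      then show False using a_mono[OF 1] a_double[of "Suc j"] j(2) assms(1) by linarith
    next
      case 2
      then show False using a_mono[OF 2] j(1) assms(2) by linarith
    qed
  qed
  then show "q \<le> 2 * a (Suc k) - a k" using j by simp
qed (use assms in \<open>auto simp: jump_def\<close>)

lemma not_jump: "q \<le> a 1 \<Longrightarrow> \<not> jump q"
proof
  assume "q \<le> a 1" "jump q"
  then obtain k where "a (Suc k) < q" "q \<le> a 1" by (auto simp: jump_def)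
  then show False using a_mono[of 1 "Suc k"] by simp
qed

text \<open>The slope is 2 up to the crossing point \<open>2 * a (Suc k) - a k + 1\<close> of the
  two lines and 1 afterwards. The initial value is a premise here, because
  \<open>profile_Suc_a\<close> obtains it from the right end of the preceding range.\<close>

lemma profile_formula_aux:
  assumes "profile (Suc (a (Suc k))) = a (Suc k) + 1 + a k"
    and "Suc (a (Suc k)) \<le> q" "q \<le> a (Suc (Suc k)) + 1"
  shows "profile q = min (q + a (Suc k)) (2 * q + a k - a (Suc k) - 1)"
  using assms(2,3)
proof (induction q rule: dec_induct)
  case base
  then show ?case using assms(1) a_double[of k] by simp
next
  case (step q)
  have jump: "jump q \<longleftrightarrow> q \<le> 2 * a (Suc k) - a k"
    using step by (intro jump_iff) auto
  have IH: "profile q = min (q + a (Suc k)) (2 * q + a k - a (Suc k) - 1)"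
    using step by simp
  have q: "Suc (a (Suc k)) \<le> q" "2 * a k \<le> a (Suc k)"
    using step(1) a_double[of k] by simp_all
  show ?case
  proof (cases "jump q")
    case True
    then have "profile (Suc q) = profile q + 2" by (simp add: profile_Suc)
    also have "\<dots> = (2 * q + a k - a (Suc k) - 1) + 2"
      unfolding IH using True q unfolding jump by (subst min_absorb2) linarith+
    also have "\<dots> = 2 * Suc q + a k - a (Suc k) - 1" using q(1) by (auto simp: le_iff_add)
    also have "\<dots> = min (Suc q + a (Suc k)) (2 * Suc q + a k - a (Suc k) - 1)"
      using True q unfolding jump by (intro min_absorb2[symmetric]) simp
    finally show ?thesis .
  next
    case False
    then have "profile (Suc q) = profile q + 1" by (simp add: profile_Suc)
    also have "\<dots> = Suc q + a (Suc k)"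
      unfolding IH using False q unfolding jump by (subst min_absorb1) linarith+
    also have "\<dots> = min (Suc q + a (Suc k)) (2 * Suc q + a k - a (Suc k) - 1)"
      using False q unfolding jump by (intro min_absorb1[symmetric]) simp
    finally show ?thesis .
  qed
qed

lemma profile_Suc_a: "profile (Suc (a (Suc k))) = a (Suc k) + 1 + a k"
proof (induction k)
  case 0
  have "(\<Sum>r<Suc (a 1). 1 + of_bool (jump r)) = (\<Sum>r<Suc (a 1). 1 :: nat)"
    by (rule sum.cong) (auto simp: not_jump)
  then show ?case by (simp add: profile_def a_0)
next
  case (Suc k)
  then show ?case
    using profile_formula_aux[of k "Suc (a (Suc (Suc k)))"] a_double[of "Suc k"] a_double[of k] a_pos[of k]
    by simp
qed

lemma profile_formula:
  assumes "a (Suc k) < q" "q \<le> a (Suc (Suc k)) + 1"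
  shows "profile q = min (q + a (Suc k)) (2 * q + a k - a (Suc k) - 1)"
  using assms by (intro profile_formula_aux profile_Suc_a) auto

lemma profile_a: "profile (a (Suc (Suc k))) = a (Suc (Suc k)) + a (Suc k)"
  using profile_formula[of k "a (Suc (Suc k))"] a_double[of k] a_double[of "Suc k"] a_pos[of k]
  by simp

text \<open>The difference \<open>P - profile\<close> is nondecreasing, vanishes at 0 and is nonpositive at
  arbitrarily large arguments.\<close>

lemma eq_profile:
  assumes P_0: "P 0 = 1" and P_1: "\<And>q. P q + 1 \<le> P (Suc q)"
    and P_2: "\<And>k q. a (Suc k) < q \<Longrightarrow> q \<le> 2 * a (Suc k) - a k \<Longrightarrow> P q + 2 \<le> P (Suc q)"
    and P_le: "\<And>n. P (a (2 * n + 2)) \<le> a (2 * n + 2) + a (2 * n + 1)"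
  shows "P q = profile q"
proof -
  have step: "P q + (1 + of_bool (jump q)) \<le> P (Suc q)" for q
    using P_1[of q] P_2[of _ q] by (auto simp: jump_def)
  have incr: "P r + profile q \<le> P q + profile r" if "r \<le> q" for r q
    using that
  proof (induction q rule: dec_induct)
    case (step q)
    then show ?case using \<open>P q + (1 + of_bool (jump q)) \<le> P (Suc q)\<close> by (simp add: profile_Suc)
  qed simp
  have "profile q \<le> P q" using incr[of 0 q] P_0 by (simp add: profile_def)
  \<comment> \<open>The index \<open>2 * q + 2\<close> is even, so the upper bound on
    \<open>P\<close> applies there, and \<open>a\<close> at this index exceeds
    \<open>q\<close>.\<close>
  moreover have "P q + profile (a (2 * q + 2)) \<le> P (a (2 * q + 2)) + profile q"
    using a_gt[of "2 * q + 2"] by (intro incr) linarith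
  then have "P q \<le> profile q"
    using P_le[of q] profile_a[of "2 * q"] by simp
  ultimately show ?thesis by simp
qed

end

section \<open>Lower and upper limits\<close>

text \<open>The values \<open>z n\<close> bound \<open>f\<close> from below far out and are also
  attained by \<open>f\<close> far out, so both have the same lower limit; a null sequence may then
  be added to \<open>z\<close>.\<close>

lemma liminf_along:
  fixes f z w :: "nat \<Rightarrow> real"
  assumes zw: "(\<lambda>n. z n - w n) \<longlonglongrightarrow> 0"
    and lower: "\<And>N. \<forall>\<^sub>F q in sequentially. \<exists>n\<ge>N. z n \<le> f q"
    and hit: "\<forall>\<^sub>F n in sequentially. \<exists>q\<ge>n. f q = z n"
  shows "liminf (\<lambda>q. ereal (f q)) = liminf (\<lambda>n. ereal (w n))"
proof -
  have "liminf (\<lambda>n. ereal (z n)) = liminf (\<lambda>n. ereal (z n - w n) + ereal (w n))" by simp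
  also have "\<dots> = 0 + liminf (\<lambda>n. ereal (w n))"
    using zw by (intro ereal_liminf_lim_add) (auto simp: zero_ereal_def)
  finally have zw_eq: "liminf (\<lambda>n. ereal (z n)) = liminf (\<lambda>n. ereal (w n))" by simp
  have "liminf (\<lambda>q. ereal (f q)) \<le> liminf (\<lambda>n. ereal (z n))"
    unfolding le_Liminf_iff
  proof (intro allI impI)
    fix y assume "y < liminf (\<lambda>q. ereal (f q))"
    then have "\<forall>\<^sub>F q in sequentially. y < ereal (f q)" by (rule less_LiminfD)
    then obtain N where N: "\<And>q. q \<ge> N \<Longrightarrow> y < ereal (f q)"
      unfolding eventually_sequentially by blast
    show "\<forall>\<^sub>F n in sequentially. y < ereal (z n)"
      using eventually_ge_at_top[of N] hit
    proof eventually_elim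
      case (elim n)
      then obtain q where "q \<ge> N" "f q = z n" using le_trans by blast
      then show ?case using N[of q] by simp
    qed
  qed
  moreover have "liminf (\<lambda>n. ereal (z n)) \<le> liminf (\<lambda>q. ereal (f q))"
    unfolding le_Liminf_iff
  proof (intro allI impI)
    fix y assume "y < liminf (\<lambda>n. ereal (z n))"
    then have "\<forall>\<^sub>F n in sequentially. y < ereal (z n)" by (rule less_LiminfD)
    then obtain N where N: "\<And>n. n \<ge> N \<Longrightarrow> y < ereal (z n)"
      unfolding eventually_sequentially by blast
    show "\<forall>\<^sub>F q in sequentially. y < ereal (f q)"
      using lower[of N]
    proof eventually_elim
      case (elim q)
      then obtain n where "n \<ge> N" "ereal (z n) \<le> ereal (f q)" by auto
      then show ?case using N[of n] by (simp add: less_le_trans)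
    qed
  qed
  ultimately show ?thesis using zw_eq by simp
qed

text \<open>Grouping the indices 2n-2 and 2n-1 produces the pairing of L_(n-1) with gamma_n + 1 in
  the final formulas.\<close>

lemma liminf_pairs:
  fixes f v r :: "nat \<Rightarrow> real"
  assumes close: "\<And>j. \<bar>v (Suc j) - r (Suc j)\<bar> \<le> 2 / real (Suc j)"
    and lower: "\<And>N. \<forall>\<^sub>F q in sequentially. \<exists>j\<ge>N. v j \<le> f q"
    and hit: "\<And>j. \<exists>q\<ge>Suc j. f q = v (Suc j)"
  shows "liminf (\<lambda>q. ereal (f q)) = liminf (\<lambda>n. ereal (min (r (2 * n - 2)) (r (2 * n - 1))))"
proof (rule liminf_along)
  let ?z = "\<lambda>n. min (v (2 * n - 2)) (v (2 * n - 1))"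
  let ?w = "\<lambda>n. min (r (2 * n - 2)) (r (2 * n - 1))"
  have close': "\<bar>v j - r j\<bar> \<le> 2 / real n" if "j \<ge> n" "n > 0" for j n
  proof -
    have "\<bar>v j - r j\<bar> \<le> 2 / real j" using close[of "j - 1"] that by simp
    also have "\<dots> \<le> 2 / real n" using that by (simp add: frac_le)
    finally show ?thesis .
  qed
  have "\<bar>?z n - ?w n\<bar> \<le> 2 / real n" if n: "n \<ge> 2" for n
    using close'[of n "2 * n - 2"] close'[of n "2 * n - 1"] n by linarith
  then have "\<forall>\<^sub>F n in sequentially. norm (?z n - ?w n) \<le> 2 / real n"
    unfolding eventually_sequentially real_norm_def by blast
  then show "(\<lambda>n. ?z n - ?w n) \<longlonglongrightarrow> 0"
    by (rule Lim_null_comparison) (rule lim_const_over_n)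
  show "\<forall>\<^sub>F q in sequentially. \<exists>n\<ge>N. ?z n \<le> f q" for N
    using lower[of "2 * N"]
  proof eventually_elim
    case (elim q)
    then obtain j where j: "j \<ge> 2 * N" "v j \<le> f q" by blast
    define n where "n = Suc (j div 2)"
    have "2 * n - 2 = j \<or> 2 * n - 1 = j" unfolding n_def by presburger
    then have "?z n \<le> f q" using j(2) by (elim disjE) (simp_all add: min_le_iff_disj)
    moreover have "N \<le> n" using j(1) unfolding n_def by linarith
    ultimately show ?case by blast
  qed
  show "\<forall>\<^sub>F n in sequentially. \<exists>q\<ge>n. f q = ?z n"
    using eventually_ge_at_top[of 2]
  proof eventually_elim
    case (elim n)
    have hit': "\<exists>q\<ge>n. f q = v j" if j: "j \<ge> n" for j
    proof -
      have "Suc (j - 1) = j" using j elim by simp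
      then obtain q where "q \<ge> j" "f q = v j" using hit[of "j - 1"] by metis
      then show ?thesis using j le_trans by blast
    qed
    have "2 * n - 2 \<ge> n" "2 * n - 1 \<ge> n" using elim by linarith+
    moreover have "?z n = v (2 * n - 2) \<or> ?z n = v (2 * n - 1)" by linarith
    ultimately show ?case using hit' by metis
  qed
qed

lemma limsup_pairs:
  fixes f v r :: "nat \<Rightarrow> real"
  assumes close: "\<And>j. \<bar>v (Suc j) - r (Suc j)\<bar> \<le> 2 / real (Suc j)"
    and upper: "\<And>N. \<forall>\<^sub>F q in sequentially. \<exists>j\<ge>N. f q \<le> v j"
    and hit: "\<And>j. \<exists>q\<ge>Suc j. f q = v (Suc j)"
  shows "limsup (\<lambda>q. ereal (f q)) = limsup (\<lambda>n. ereal (max (r (2 * n - 2)) (r (2 * n - 1))))"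
proof -
  have "liminf (\<lambda>q. ereal (- f q)) = liminf (\<lambda>n. ereal (min (- r (2 * n - 2)) (- r (2 * n - 1))))"
  proof (rule liminf_pairs[where v = "\<lambda>j. - v j"])
    show "\<bar>- v (Suc j) - - r (Suc j)\<bar> \<le> 2 / real (Suc j)" for j using close[of j] by linarith
  qed (use upper hit in auto)
  moreover have "min (- x) (- y) = - max x y" for x y :: real by simp
  ultimately have "liminf (\<lambda>q. - ereal (f q)) = liminf (\<lambda>n. - ereal (max (r (2 * n - 2)) (r (2 * n - 1))))"
    by (simp only: uminus_ereal.simps)
  then show ?thesis by (simp only: ereal_Liminf_uminus ereal_uminus_eq_iff)
qed

section \<open>Local minima and maxima of the ratio of \<open>profile q\<close> to
  \<open>q\<close>\<close>

context doubling
begin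

lemma obtain_index:
  assumes "a N < q"
  obtains j where "j \<ge> N" "a j < q" "q \<le> a (Suc j) + 1"
proof -
  define j where "j = (LEAST j. j \<ge> N \<and> q \<le> a (Suc j) + 1)"
  have ex: "N + q \<ge> N \<and> q \<le> a (Suc (N + q)) + 1" using a_gt[of "Suc (N + q)"] by linarith
  have j: "j \<ge> N \<and> q \<le> a (Suc j) + 1" unfolding j_def by (rule LeastI[of _ "N + q"]) (rule ex)
  moreover have "a j < q"
  proof (cases "j = N")
    case False
    then have "\<not> (j - 1 \<ge> N \<and> q \<le> a (Suc (j - 1)) + 1)"
      using j unfolding j_def by (intro not_less_Least) linarith
    then show ?thesis using j False by (cases j) auto
  qed (use assms in simp)
  ultimately show ?thesis using that by blast
qed

text \<open>For positive \<open>j\<close>, the ratio at \<open>q = a j + 1\<close>, where slope 1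
  changes to slope 2 (for \<open>j = 1\<close> too, by \<open>not_jump\<close>).\<close>

definition local_min :: "nat \<Rightarrow> real" where
  "local_min j = 1 + real (a (j - 1)) / (real (a j) + 1)"

text \<open>For positive \<open>j\<close>, the ratio at \<open>q = 2 * a j - a (j - 1) + 1\<close>,
  where slope 2 changes back to slope 1.\<close>

definition local_max :: "nat \<Rightarrow> real" where
  "local_max j = (3 * real (a j) - real (a (j - 1)) + 1) / (2 * real (a j) - real (a (j - 1)) + 1)"

lemma real_profile:
  assumes "a (Suc k) < q" "q \<le> a (Suc (Suc k)) + 1"
  shows "real (profile q) = min (real q + real (a (Suc k))) (2 * real q + real (a k) - real (a (Suc k)) - 1)"
proof -
  have "a (Suc k) + 1 \<le> 2 * q + a k" using assms by simp
  then have "real (2 * q + a k - a (Suc k) - 1) = 2 * real q + real (a k) - real (a (Suc k)) - 1"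
    by linarith
  then show ?thesis by (simp add: profile_formula[OF assms] of_nat_min)
qed

text \<open>On the piece of slope 1 the ratio is 1 plus a constant over \<open>q\<close> and
  decreases to the right end; on the piece of slope 2 it is 2 minus a positive constant over
  \<open>q\<close> and is least at the left end.\<close>

lemma profile_lower:
  assumes "a (Suc k) < q" "q \<le> a (Suc (Suc k)) + 1"
  shows "\<exists>j\<in>{Suc k, Suc (Suc k)}. local_min j \<le> real (profile q) / real q"
proof -
  have q: "real q > 0" "real q \<ge> real (a (Suc k)) + 1" "real q \<le> real (a (Suc (Suc k))) + 1"
    using assms by linarith+
  have A: "2 * real (a k) \<le> real (a (Suc k))" using a_double[of k] by linarith
  consider "real (profile q) = real q + real (a (Suc k))"
    | "real (profile q) = 2 * real q + real (a k) - real (a (Suc k)) - 1"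
    using real_profile[OF assms] by linarith
  then show ?thesis
  proof cases
    case 1
    then have "real (profile q) / real q = 1 + real (a (Suc k)) / real q"
      using q by (simp add: field_simps)
    also have "\<dots> \<ge> local_min (Suc (Suc k))"
      unfolding local_min_def using q by (simp add: frac_le)
    finally show ?thesis by blast
  next
    case 2
    then have "real (profile q) / real q = 2 - (real (a (Suc k)) + 1 - real (a k)) / real q"
      using q by (simp add: field_simps)
    also have "\<dots> \<ge> 2 - (real (a (Suc k)) + 1 - real (a k)) / (real (a (Suc k)) + 1)"
      using q A by (intro diff_left_mono frac_le) linarith+
    moreover have "2 - (real (a (Suc k)) + 1 - real (a k)) / (real (a (Suc k)) + 1) = local_min (Suc k)"
      unfolding local_min_def by (simp add: field_simps)
    ultimately show ?thesis by auto
  qed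
qed

lemma profile_lower_attained: "\<exists>q\<ge>Suc k. real (profile q) / real q = local_min (Suc k)"
proof (intro exI conjI)
  show "Suc (a (Suc k)) \<ge> Suc k" using a_gt[of "Suc k"] by simp
  have "real (profile (Suc (a (Suc k)))) = (real (a (Suc k)) + 1) + real (a k)"
    by (simp add: profile_Suc_a)
  then show "real (profile (Suc (a (Suc k)))) / real (Suc (a (Suc k))) = local_min (Suc k)"
    by (simp add: local_min_def field_simps)
qed

lemma profile_upper:
  assumes "a (Suc k) < q" "q \<le> a (Suc (Suc k)) + 1"
  shows "real (profile q) / real q \<le> local_max (Suc k)"
proof -
  define A B where "A = real (a k)" and "B = real (a (Suc k))"
  have q: "real q > 0" using assms by linarith
  have A: "2 * A \<le> B" "A \<ge> 1" using a_double[of k] a_pos[of k] by (auto simp: A_def B_def)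
  \<comment> \<open>The two lines bounding the profile cross at \<open>t\<close>, with common value
    \<open>t + B\<close>. The ratio along the slope 2 line increases and along the other decreases,
    so \<open>t\<close> is the place of the maximum.\<close>
  define t where "t = 2 * B - A + 1"
  have t: "t > 0" "3 * B - A + 1 = t + B" "2 * t + A - B - 1 = t + B"
    using A by (auto simp: t_def)
  have p: "real (profile q) \<le> real q + B" "real (profile q) \<le> 2 * real q + A - B - 1"
    using real_profile[OF assms] by (auto simp: A_def B_def)
  have "real (profile q) * t \<le> (t + B) * real q"
  proof (cases "real q \<ge> t")
    case True
    have "real (profile q) * t \<le> (real q + B) * t" using p(1) t(1) by simp
    also have "\<dots> \<le> (t + B) * real q" using mult_left_mono[OF True, of B] A by (simp add: algebra_simps)
    finally show ?thesis .
  next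
    case False
    have "real (profile q) * t \<le> (2 * real q + A - B - 1) * t" using p(2) t(1) by simp
    also have "\<dots> = (t + B) * real q + (B + 1 - A) * (real q - t)"
      unfolding t_def by (simp add: algebra_simps)
    also have "\<dots> \<le> (t + B) * real q"
      using False A mult_nonneg_nonpos[of "B + 1 - A" "real q - t"] by simp
    finally show ?thesis .
  qed
  then have "real (profile q) / real q \<le> (t + B) / t" using q t(1) by (simp add: field_simps)
  moreover have "local_max (Suc k) = (3 * B - A + 1) / t"
    by (simp add: local_max_def A_def B_def t_def)
  ultimately show ?thesis using t(2) by simp
qed

lemma profile_upper_attained: "\<exists>q\<ge>Suc k. real (profile q) / real q = local_max (Suc k)"
proof (intro exI conjI)
  let ?q = "2 * a (Suc k) - a k + 1"
  show "?q \<ge> Suc k" using a_gt[of "Suc k"] a_double[of k] by linarith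
  have q: "real ?q = 2 * real (a (Suc k)) - real (a k) + 1"
    using a_double[of k] by linarith
  have "real (profile ?q) = min (real ?q + real (a (Suc k))) (2 * real ?q + real (a k) - real (a (Suc k)) - 1)"
    using a_double[of k] a_double[of "Suc k"] a_pos[of "Suc k"] by (intro real_profile) linarith+
  then have "real (profile ?q) = 3 * real (a (Suc k)) - real (a k) + 1"
    unfolding q by simp
  then show "real (profile ?q) / real ?q = local_max (Suc k)"
    unfolding q local_max_def by simp
qed

lemma close_aux:
  fixes r :: real
  assumes "\<bar>real (a k) / real (a (Suc k)) - r\<bar> \<le> 1 / real (a k)" "0 \<le> r" "r \<le> 1"
  shows "\<bar>local_min (Suc k) - (1 + r)\<bar> \<le> 2 / real (Suc k)"
    and "\<bar>local_max (Suc k) - (3 - r) / (2 - r)\<bar> \<le> 2 / real (Suc k)"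
proof -
  define A B where "A = real (a k)" and "B = real (a (Suc k))"
  have A: "2 * A \<le> B" "A \<ge> 1" "A \<ge> real (Suc k)" "B > 0"
    using a_double[of k] a_pos[of k] a_gt[of k] by (auto simp: A_def B_def)
  have r: "\<bar>A / B - r\<bar> \<le> 1 / A" using assms(1) by (simp add: A_def B_def)
  have BA: "0 \<le> 1 / B" "1 / B \<le> 1 / A" using A by (simp_all add: frac_le)
  have k: "1 / A \<le> 1 / real (Suc k)" using A by (intro divide_left_mono) auto
  have "A / B - A / (B + 1) = A / (B + 1) * (1 / B)" using A by (simp add: field_simps)
  moreover have "A / (B + 1) * (1 / B) \<le> 1 * (1 / B)" using A by (intro mult_right_mono) auto
  moreover have "0 \<le> A / (B + 1) * (1 / B)" using A by simp
  moreover have "local_min (Suc k) = 1 + A / (B + 1)" by (simp add: local_min_def A_def B_def)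
  ultimately show "\<bar>local_min (Suc k) - (1 + r)\<bar> \<le> 2 / real (Suc k)"
    using r BA k by linarith
  \<comment> \<open>With this \<open>s\<close>, which absorbs the additive 1,
    \<open>local_max\<close> is exactly the value at \<open>s\<close> of x -> (3-x)/(2-x). Below 1
    this function has Lipschitz constant 1, so closeness of \<open>s\<close> and \<open>r\<close>
    suffices.\<close>
  define s where "s = (A - 1) / B"
  have "s = A / B - 1 / B" by (simp add: s_def diff_divide_distrib)
  then have sr: "\<bar>s - r\<bar> \<le> 2 / real (Suc k)" using r BA k by linarith
  have "s \<le> 1" using A by (simp add: s_def)
  have "3 - s = (3 * B - A + 1) / B" "2 - s = (2 * B - A + 1) / B"
    using A by (simp_all add: s_def field_simps)
  then have "local_max (Suc k) = (3 - s) / (2 - s)"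
    using A(4) by (simp add: local_max_def A_def B_def)
  moreover have "(3 - s) * (2 - r) - (3 - r) * (2 - s) = s - r" by (simp add: algebra_simps)
  ultimately have "local_max (Suc k) - (3 - r) / (2 - r) = (s - r) / ((2 - s) * (2 - r))"
    using \<open>s \<le> 1\<close> assms(3) by (simp add: diff_frac_eq)
  then have "\<bar>local_max (Suc k) - (3 - r) / (2 - r)\<bar> = \<bar>s - r\<bar> / ((2 - s) * (2 - r))"
    using \<open>s \<le> 1\<close> assms(3) by (simp add: abs_mult)
  also have "\<dots> \<le> \<bar>s - r\<bar> / 1"
    using \<open>s \<le> 1\<close> assms(3) mult_mono[of 1 "2 - s" 1 "2 - r"] by (intro divide_left_mono) auto
  also have "\<dots> \<le> 2 / real (Suc k)" using sr by simp
  finally show "\<bar>local_max (Suc k) - (3 - r) / (2 - r)\<bar> \<le> 2 / real (Suc k)" .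
qed

lemma profile_limits:
  fixes r :: "nat \<Rightarrow> real"
  assumes r: "\<And>k. \<bar>real (a k) / real (a (Suc k)) - r (Suc k)\<bar> \<le> 1 / real (a k)"
    and "\<And>k. 0 \<le> r (Suc k)" "\<And>k. r (Suc k) \<le> 1"
  shows "liminf (\<lambda>q. ereal (real (profile q) / real q))
      = liminf (\<lambda>n. ereal (min (1 + r (2 * n - 2)) (1 + r (2 * n - 1))))" (is ?inf)
    and "limsup (\<lambda>q. ereal (real (profile q) / real q))
      = limsup (\<lambda>n. ereal (max ((3 - r (2 * n - 2)) / (2 - r (2 * n - 2)))
                               ((3 - r (2 * n - 1)) / (2 - r (2 * n - 1)))))" (is ?sup)
proof -
  have index: "\<exists>j. Suc j \<ge> N \<and> a (Suc j) < q \<and> q \<le> a (Suc (Suc j)) + 1"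
    if "a (Suc N) < q" for N q
  proof -
    from that obtain i where i: "i \<ge> Suc N" "a i < q" "q \<le> a (Suc i) + 1"
      by (rule obtain_index)
    then obtain j where "i = Suc j" by (cases i) auto
    then show ?thesis using i by (intro exI[of _ j]) simp
  qed
  show ?inf
  proof (rule liminf_pairs[where v = local_min and r = "\<lambda>j. 1 + r j"])
    show "\<forall>\<^sub>F q in sequentially. \<exists>j\<ge>N. local_min j \<le> real (profile q) / real q" for N
      using eventually_gt_at_top[of "a (Suc N)"]
    proof eventually_elim
      case (elim q)
      then obtain j where j: "Suc j \<ge> N" "a (Suc j) < q" "q \<le> a (Suc (Suc j)) + 1"
        using index by blast
      then show ?case using profile_lower[OF j(2,3)] by (auto intro: le_SucI)
    qed
  qed (use assms close_aux(1) profile_lower_attained in auto)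
  show ?sup
  proof (rule limsup_pairs[where v = local_max and r = "\<lambda>j. (3 - r j) / (2 - r j)"])
    show "\<forall>\<^sub>F q in sequentially. \<exists>j\<ge>N. real (profile q) / real q \<le> local_max j" for N
      using eventually_gt_at_top[of "a (Suc N)"]
    proof eventually_elim
      case (elim q)
      then show ?case using index profile_upper by blast
    qed
  qed (use assms close_aux(2) profile_upper_attained in auto)
qed

end

section \<open>Complexity of the rank-one subshift\<close>

context rank_one
begin

definition len_seq :: "nat \<Rightarrow> nat" where
  "len_seq k = (if even k then length (blk (k div 2)) else length (ublk (k div 2)))"

lemma len_seq_even: "len_seq (2 * n) = length (blk n)"
  and len_seq_odd: "len_seq (Suc (2 * n)) = length (ublk n)"
  by (simp_all add: len_seq_def)

sublocale doubling len_seq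
proof
  show "len_seq 0 = 1" by (simp add: len_seq_def blk_0)
  show "2 * len_seq k \<le> len_seq (Suc k)" for k
  proof (cases "even k")
    case True
    then obtain n where "k = 2 * n" by blast
    then show ?thesis using length_ublk_ge[of n] by (simp add: len_seq_even len_seq_odd)
  next
    case False
    then obtain n where "k = Suc (2 * n)" using oddE by fastforce
    then show ?thesis
      using length_blk_Suc_ge[of n] len_seq_even[of "Suc n"] by (simp add: len_seq_odd)
  qed
qed

lemma complexity_profile: "complexity L g q = profile q"
  unfolding complexity_eq
proof (rule eq_profile)
  show "card (lang_len 0) = 1" by (simp add: lang_len_0)
  show "card (lang_len q) + 1 \<le> card (lang_len (Suc q))" for q by (rule card_lang_len_step_1)
  show "card (lang_len q) + 2 \<le> card (lang_len (Suc q))"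
    if "len_seq (Suc k) < q" "q \<le> 2 * len_seq (Suc k) - len_seq k" for k q
  proof (cases "even k")
    case True
    then obtain n where "k = 2 * n" by blast
    then show ?thesis
      using that card_lang_len_step_spaced[of n q] by (simp add: len_seq_even len_seq_odd)
  next
    case False
    then obtain n where "k = Suc (2 * n)" using oddE by fastforce
    then show ?thesis
      using that card_lang_len_step_unspaced[of n q] len_seq_even[of "Suc n"] by (simp add: len_seq_odd)
  qed
  show "card (lang_len (len_seq (2 * n + 2))) \<le> len_seq (2 * n + 2) + len_seq (2 * n + 1)" for n
    using card_lang_len_blk[of n] len_seq_even[of "Suc n"] len_seq_odd[of n] by simp
qed

lemma complexity_block_len:
  assumes "n \<ge> 1"
  shows "real (complexity L g (block_len L g (n + 1)))
    = (1 + 1 / real (L n)) * real (block_len L g (n + 1))"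
proof -
  obtain m where m: "n = Suc m" using assms by (cases n) auto
  have h: "block_len L g (n + 1) = length (blk (Suc m))" by (simp add: block_len_def blk_def m)
  have "profile (length (blk (Suc m))) = length (blk (Suc m)) + length (ublk m)"
    using profile_a[of "2 * m"] len_seq_even[of "Suc m"] len_seq_odd[of m] by simp
  moreover have "L n \<noteq> 0" using L_gt_1[OF assms] by simp
  ultimately show ?thesis
    unfolding complexity_profile h by (simp add: length_blk_Suc m field_simps)
qed

text \<open>The approximation of \<open>len_seq (j - 1) / len_seq j\<close> for positive
  \<open>j\<close>: exact for even \<open>j\<close>, and with the spacers in \<open>ublk\<close>
  neglected for odd \<open>j\<close>.\<close>

definition ratio :: "nat \<Rightarrow> real" where
  "ratio j = 1 / real (if even j then L (j div 2) else g (Suc (j div 2)) + 1)"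

lemma ratio_close: "\<bar>real (len_seq k) / real (len_seq (Suc k)) - ratio (Suc k)\<bar> \<le> 1 / real (len_seq k)"
proof (cases "even k")
  case True
  then obtain n where k: "k = 2 * n" by blast
  define h c where "h = real (length (blk n))" and "c = real (g (Suc n))"
  have pos: "h \<ge> 1" "c \<ge> 1"
    using length_blk_pos[of n] g_gt_1[of "Suc n"] by (auto simp: h_def c_def Suc_le_eq)
  define D where "D = (c + 1) * h + c"
  have u: "real (len_seq (Suc k)) = D"
    unfolding k len_seq_odd length_ublk h_def c_def D_def by (simp add: algebra_simps)
  have r: "ratio (Suc k) = 1 / (c + 1)" by (simp add: ratio_def k c_def)
  have D: "D - h * (c + 1) = c" "D \<ge> h"
    using pos by (simp_all add: D_def algebra_simps)
  then have "1 / (c + 1) - h / D = c / (c + 1) * (1 / D)"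
    using pos by (simp add: diff_frac_eq)
  moreover have "c / (c + 1) * (1 / D) \<le> 1 * (1 / h)"
    using pos D by (intro mult_mono divide_left_mono) auto
  moreover have "0 \<le> c / (c + 1) * (1 / D)" using pos D by simp
  ultimately show ?thesis unfolding u r by (simp add: k len_seq_even h_def)
next
  case False
  then obtain n where k: "k = Suc (2 * n)" using oddE by fastforce
  have "len_seq (Suc k) = L (Suc n) * length (ublk n)"
    using len_seq_even[of "Suc n"] by (simp add: k length_blk_Suc)
  moreover have "length (ublk n) \<noteq> 0" using length_ublk_ge[of n] by linarith
  ultimately show ?thesis by (simp add: k len_seq_odd ratio_def)
qed

lemma ratio_bounds: "0 \<le> ratio j" "ratio j \<le> 1"
proof -
  \<comment> \<open>The case \<open>m = 0\<close>, where the quotient is 0 by convention, covers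
    \<open>ratio 0\<close>, as nothing is assumed about \<open>L 0\<close>.\<close>
  have "1 / real m \<le> 1" for m by (cases m) simp_all
  then show "ratio j \<le> 1" unfolding ratio_def by blast
qed (simp add: ratio_def)

lemma ratio_indices:
  assumes "n \<ge> 2"
  shows "ratio (2 * n - 2) = 1 / real (L (n - 1))" "ratio (2 * n - 1) = 1 / real (g n + 1)"
proof -
  have "2 * n - 2 = 2 * (n - 1)" "2 * n - 1 = Suc (2 * (n - 1))" "Suc (n - 1) = n"
    using assms by linarith+
  then show "ratio (2 * n - 2) = 1 / real (L (n - 1))" "ratio (2 * n - 1) = 1 / real (g n + 1)"
    by (simp_all only: ratio_def) simp_all
qed

lemma liminf_complexity:
  "liminf (\<lambda>q. ereal (real (complexity L g q) / real q))
    = 1 + liminf (\<lambda>n. ereal (1 / real (max (L (n - 1)) (g n + 1))))"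
proof -
  have "liminf (\<lambda>q. ereal (real (complexity L g q) / real q))
      = liminf (\<lambda>n. ereal (min (1 + ratio (2 * n - 2)) (1 + ratio (2 * n - 1))))"
    unfolding complexity_profile by (rule profile_limits(1)[OF ratio_close ratio_bounds])
  also have "\<dots> = liminf (\<lambda>n. 1 + ereal (1 / real (max (L (n - 1)) (g n + 1))))"
  proof (rule Liminf_eq)
    show "\<forall>\<^sub>F n in sequentially. ereal (min (1 + ratio (2 * n - 2)) (1 + ratio (2 * n - 1)))
        = 1 + ereal (1 / real (max (L (n - 1)) (g n + 1)))"
      \<comment> \<open>From 2 on, \<open>n - 1\<close> is a genuine index of \<open>L\<close>;
        finitely many earlier terms do not affect the limit.\<close>
      using eventually_ge_at_top[of 2]
    proof eventually_elim
      case (elim n)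
      define x y where "x = real (L (n - 1))" and "y = real (g n + 1)"
      have "n - 1 \<ge> 1" using elim by linarith
      then have xy: "x > 0" "y > 0" using L_gt_1[of "n - 1"] by (simp_all add: x_def y_def)
      have mono: "1 / t \<le> 1 / s" if "0 < s" "s \<le> t" for s t :: real
        using that by (intro divide_left_mono) auto
      have "min (1 + 1 / x) (1 + 1 / y) = 1 + 1 / max x y"
        using mono[of x y] mono[of y x] xy by (cases "x \<le> y") (auto simp: max_def min_def)
      then show ?case
        unfolding ratio_indices[OF elim] of_nat_max x_def y_def by (simp add: one_ereal_def)
    qed
  qed
  also have "\<dots> = 1 + liminf (\<lambda>n. ereal (1 / real (max (L (n - 1)) (g n + 1))))"
    by (rule Liminf_add_ereal_left) auto
  finally show ?thesis .
qed

lemma limsup_complexity: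
  "limsup (\<lambda>q. ereal (real (complexity L g q) / real q))
    = 3/2 + limsup (\<lambda>n. ereal (1 / (4 * real (min (L (n - 1)) (g n + 1)) - 2)))"
proof -
  have "limsup (\<lambda>q. ereal (real (complexity L g q) / real q))
      = limsup (\<lambda>n. ereal (max ((3 - ratio (2 * n - 2)) / (2 - ratio (2 * n - 2)))
                               ((3 - ratio (2 * n - 1)) / (2 - ratio (2 * n - 1)))))"
    unfolding complexity_profile by (rule profile_limits(2)[OF ratio_close ratio_bounds])
  also have "\<dots> = limsup (\<lambda>n. ereal (3/2) + ereal (1 / (4 * real (min (L (n - 1)) (g n + 1)) - 2)))"
  proof (rule Limsup_eq)
    show "\<forall>\<^sub>F n in sequentially.
        ereal (max ((3 - ratio (2 * n - 2)) / (2 - ratio (2 * n - 2)))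
                   ((3 - ratio (2 * n - 1)) / (2 - ratio (2 * n - 1))))
        = ereal (3/2) + ereal (1 / (4 * real (min (L (n - 1)) (g n + 1)) - 2))"
      using eventually_ge_at_top[of 2]
    proof eventually_elim
      case (elim n)
      define x y where "x = real (L (n - 1))" and "y = real (g n + 1)"
      have "n - 1 \<ge> 1" using elim by linarith
      then have xy: "x \<ge> 1" "y \<ge> 1" using L_gt_1[of "n - 1"] by (simp_all add: x_def y_def)
      \<comment> \<open>The left side is (3t-1)/(2t-1), and splitting off 3/2 leaves half of
        1/(2t-1).\<close>
      have eq: "(3 - 1 / t) / (2 - 1 / t) = 3/2 + 1 / (4 * t - 2)" if "t \<ge> 1" for t :: real
        using that by (simp add: field_simps)
      have mono: "1 / (4 * t - 2) \<le> 1 / (4 * s - 2)" if "1 \<le> s" "s \<le> t" for s t :: real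
        using that by (intro divide_left_mono) auto
      have "max (3/2 + 1 / (4 * x - 2)) (3/2 + 1 / (4 * y - 2)) = 3/2 + 1 / (4 * min x y - 2)"
        using mono[of x y] mono[of y x] xy by (cases "x \<le> y") (auto simp: max_def min_def)
      then have "max ((3 - 1 / x) / (2 - 1 / x)) ((3 - 1 / y) / (2 - 1 / y)) = 3/2 + 1 / (4 * min x y - 2)"
        by (simp only: eq[OF xy(1)] eq[OF xy(2)])
      then show ?case
        unfolding ratio_indices[OF elim] by (simp add: x_def y_def of_nat_min)
    qed
  qed
  also have "\<dots> = ereal (3/2) + limsup (\<lambda>n. ereal (1 / (4 * real (min (L (n - 1)) (g n + 1)) - 2)))"
    by (rule ereal_limsup_lim_add) auto
  also have "ereal (3/2) = 3/2" by (simp add: numeral_eq_ereal)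
  finally show ?thesis .
qed

end

theorem theorem4:
  fixes L g :: "nat \<Rightarrow> nat"
  assumes "\<forall>n\<ge>1. L n > 1" and "\<forall>n\<ge>1. g n > 1"
  shows "(\<forall>n\<ge>1. real (complexity L g (block_len L g (n+1)))
            = (1 + 1 / real (L n)) * real (block_len L g (n+1)))
       \<and> ((\<lambda>n. real (g n) / real (block_len L g n)) \<longlonglongrightarrow> 0 \<longrightarrow>
            liminf (\<lambda>q. ereal (real (complexity L g q) / real q))
              = 1 + liminf (\<lambda>n. ereal (1 / real (max (L (n-1)) (g n + 1))))
          \<and> limsup (\<lambda>q. ereal (real (complexity L g q) / real q))
              = 3/2 + limsup (\<lambda>n. ereal (1 / (4 * real (min (L (n-1)) (g n + 1)) - 2))))"
proof -
  interpret rank_one L g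
    using assms by unfold_locales simp_all
  show ?thesis
    using complexity_block_len liminf_complexity limsup_complexity by blast
qed

end
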